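(* Let $d\ge 1$, let $0<s_0<s_1$ and $0<\alpha_0<\alpha_1$, set $W=[s_0,s_1]\times[\alpha_0,\alpha_1]$, and let $g\in L^2_0(\mathbb{T}^d;\mathbb{C})$ with Fourier coefficients $(\hat g_k)_{k\in\mathbb{Z}^d}$. Define $\mathcal{S}:W\to\ell^2(\mathbb{Z}^d)$ by $$\mathcal{S}(s,\alpha)=\Big(\frac{\alpha}{\alpha+|k|^{2s}}\,\hat g_k\Big)_{k\in\mathbb{Z}^d}.$$ Then $\mathcal{S}$ is twice Fréchet differentiable on $W$ (in particular continuous). For $h_1,h_2\in\mathbb{R}$ its partial derivatives up to order two are given by $\partial_s\mathcal{S}(s,\alpha)[h_1]=h_1\partial_s\mathcal{S}(s,\alpha)$, $\partial_s^2\mathcal{S}(s,\alpha)[h_1,h_2]=h_1h_2\partial_s^2\mathcal{S}(s,\alpha)$, $\partial_\alpha\mathcal{S}(s,\alpha)[h_1]=h_1\partial_\alpha\mathcal{S}(s,\alpha)$, $\partial_\alpha^2\mathcal{S}(s,\alpha)[h_1,h_2]=h_1h_2\partial_\alpha^2\mathcal{S}(s,\alpha)$, $\partial_{\alpha,s}\mathcal{S}(s,\alpha)[h_1,h_2]=h_1h_2\partial_{\alpha,s}\mathcal{S}(s,\alpha)$, where the following sequences are indexed by $k\in\mathbb{Z}^d\setminus\{0\}$ (the $k=0$ entries being $0$): $$\partial_s\mathcal{S}(s,\alpha)=\Big(-\frac{2\alpha|k|^{2s}\ln|k|}{(|k|^{2s}+\alpha)^2}\hat g_k\Big)_k,\qquad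 \partial_s^2\mathcal{S}(s,\alpha)=\Big(\frac{4\alpha|k|^{2s}(\ln|k|)^2(|k|^{2s}-\alpha)}{(\alpha+|k|^{2s})^3}\hat g_k\Big)_k,$$ $$\partial_\alpha\mathcal{S}(s,\alpha)=\Big(\frac{|k|^{2s}}{(|k|^{2s}+\alpha)^2}\hat g_k\Big)_k,\qquad \partial_\alpha^2\mathcal{S}(s,\alpha)=\Big(\frac{-2|k|^{2s}}{(|k|^{2s}+\alpha)^3}\hat g_k\Big)_k,$$ $$\partial_{\alpha,s}\mathcal{S}(s,\alpha)=\Big(\frac{-2|k|^{2s}\ln|k|\,(|k|^{2s}-\alpha)}{(|k|^{2s}+\alpha)^3}\hat g_k\Big)_k.$$
   Context: $\mathbb{T}^d=\mathbb{R}^d/(2\pi\mathbb{Z})^d$; $L^2_0(\mathbb{T}^d;\mathbb{C})$ denotes the square-integrable complex functions with zero mean. With $\varphi^k(x)=e^{ik\cdot x}$, the Fourier coefficients are $\hat u_k=(u,\varphi^k)_{L^2}=\int_{\mathbb{T}^d}u\,\overline{\varphi^k}\,dx$, so that $u=(2\pi)^{-d}\sum_k\hat u_k\varphi^k$. The convention $|0|^{2s}=0$ is used, so the $k=0$ entry of $\mathcal{S}(s,\alpha)$ is $\hat g_0=0$. $\mathcal{S}(s,\alpha)$ is the Fourier coefficient sequence of the solution $u$ of $(-\Delta)^s u+\alpha u=\alpha g$. *)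

theory Defs
  imports "HOL-Analysis.Analysis"
begin

definition knorm :: "int ^ 'd \<Rightarrow> real" where
  "knorm k = norm ((\<chi> i. real_of_int (k $ i)) :: real ^ 'd)"

definition kdot :: "int ^ 'd \<Rightarrow> real ^ 'd \<Rightarrow> real" where
  "kdot k x = (\<Sum>i\<in>UNIV. real_of_int (k $ i) * x $ i)"

definition cell :: "(real ^ 'd) set" where
  "cell = cbox 0 (\<chi> i. 2 * pi)"

definition L2_0_torus :: "(real ^ 'd \<Rightarrow> complex) \<Rightarrow> bool" where
  "L2_0_torus g \<longleftrightarrow>
     (\<forall>x i. g (x + (2 * pi) *\<^sub>R axis i 1) = g x) \<and>
     g measurable_on cell \<and>
     (\<lambda>x. (cmod (g x))\<^sup>2) integrable_on cell \<and>
     integral cell g = 0"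

definition fourier_coeff :: "(real ^ 'd \<Rightarrow> complex) \<Rightarrow> int ^ 'd \<Rightarrow> complex" where
  "fourier_coeff g k = integral cell (\<lambda>x. g x * exp (- \<i> * complex_of_real (kdot k x)))"

definition in_l2 :: "('i \<Rightarrow> complex) \<Rightarrow> bool" where
  "in_l2 x \<longleftrightarrow> (\<lambda>k. (cmod (x k))\<^sup>2) summable_on UNIV"

definition l2norm :: "('i \<Rightarrow> complex) \<Rightarrow> real" where
  "l2norm x = sqrt (\<Sum>\<^sub>\<infinity>k. (cmod (x k))\<^sup>2)"

definition l2opnorm :: "('a::real_normed_vector \<Rightarrow> 'i \<Rightarrow> complex) \<Rightarrow> real" where
  "l2opnorm T = Sup ((\<lambda>h. l2norm (T h)) ` {h. norm h \<le> 1})"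

definition l2_bounded_linear :: "('a::real_normed_vector \<Rightarrow> 'i \<Rightarrow> complex) \<Rightarrow> bool" where
  "l2_bounded_linear D \<longleftrightarrow>
     (\<forall>x y. D (x + y) = (\<lambda>k. D x k + D y k)) \<and>
     (\<forall>c x. D (c *\<^sub>R x) = (\<lambda>k. complex_of_real c * D x k)) \<and>
     (\<exists>C. \<forall>x. in_l2 (D x) \<and> l2norm (D x) \<le> C * norm x)"

definition l2_has_frechet_within ::
  "('a::real_normed_vector \<Rightarrow> 'i \<Rightarrow> complex) \<Rightarrow> ('a \<Rightarrow> 'i \<Rightarrow> complex) \<Rightarrow> 'a set \<Rightarrow> 'a \<Rightarrow> bool" where
  "l2_has_frechet_within F D W p \<longleftrightarrow>
     l2_bounded_linear D \<and>
     (\<forall>\<epsilon>>0. \<exists>\<delta>>0. \<forall>q\<in>W. norm (q - p) < \<delta> \<longrightarrow>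
        l2norm (\<lambda>k. F q k - F p k - D (q - p) k) \<le> \<epsilon> * norm (q - p))"

definition op_bounded_linear :: "('a::real_normed_vector \<Rightarrow> 'a \<Rightarrow> 'i \<Rightarrow> complex) \<Rightarrow> bool" where
  "op_bounded_linear D \<longleftrightarrow>
     (\<forall>x y. D (x + y) = (\<lambda>h k. D x h k + D y h k)) \<and>
     (\<forall>c x. D (c *\<^sub>R x) = (\<lambda>h k. complex_of_real c * D x h k)) \<and>
     (\<forall>x. l2_bounded_linear (D x)) \<and>
     (\<exists>C. \<forall>x. l2opnorm (D x) \<le> C * norm x)"

definition op_has_frechet_within ::
  "('a::real_normed_vector \<Rightarrow> 'a \<Rightarrow> 'i \<Rightarrow> complex) \<Rightarrow> ('a \<Rightarrow> 'a \<Rightarrow> 'i \<Rightarrow> complex) \<Rightarrow> 'a set \<Rightarrow> 'a \<Rightarrow> bool" where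
  "op_has_frechet_within G D W p \<longleftrightarrow>
     op_bounded_linear D \<and>
     (\<forall>\<epsilon>>0. \<exists>\<delta>>0. \<forall>q\<in>W. norm (q - p) < \<delta> \<longrightarrow>
        l2opnorm (\<lambda>h k. G q h k - G p h k - D (q - p) h k) \<le> \<epsilon> * norm (q - p))"

definition l2_continuous_on :: "'a::real_normed_vector set \<Rightarrow> ('a \<Rightarrow> 'i \<Rightarrow> complex) \<Rightarrow> bool" where
  "l2_continuous_on W F \<longleftrightarrow>
     (\<forall>p\<in>W. \<forall>\<epsilon>>0. \<exists>\<delta>>0. \<forall>q\<in>W. norm (q - p) < \<delta> \<longrightarrow> l2norm (\<lambda>k. F q k - F p k) < \<epsilon>)"

(* The solution map S(s,alpha) and the sequences of its partial derivatives.
   Note 0 powr a = 0 realises the convention |0|^{2s} = 0. *)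
definition solS :: "(int ^ 'd \<Rightarrow> complex) \<Rightarrow> real \<times> real \<Rightarrow> int ^ 'd \<Rightarrow> complex" where
  "solS gh = (\<lambda>(s, a) k. complex_of_real (a / (a + knorm k powr (2 * s))) * gh k)"

definition dS_s :: "(int ^ 'd \<Rightarrow> complex) \<Rightarrow> real \<Rightarrow> real \<Rightarrow> int ^ 'd \<Rightarrow> complex" where
  "dS_s gh s a k = (if k = 0 then 0 else
     complex_of_real (- (2 * a * knorm k powr (2 * s) * ln (knorm k))
                      / (knorm k powr (2 * s) + a)\<^sup>2) * gh k)"

definition dS_ss :: "(int ^ 'd \<Rightarrow> complex) \<Rightarrow> real \<Rightarrow> real \<Rightarrow> int ^ 'd \<Rightarrow> complex" where
  "dS_ss gh s a k = (if k = 0 then 0 else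
     complex_of_real (4 * a * knorm k powr (2 * s) * (ln (knorm k))\<^sup>2 * (knorm k powr (2 * s) - a)
                      / (a + knorm k powr (2 * s)) ^ 3) * gh k)"

definition dS_a :: "(int ^ 'd \<Rightarrow> complex) \<Rightarrow> real \<Rightarrow> real \<Rightarrow> int ^ 'd \<Rightarrow> complex" where
  "dS_a gh s a k = (if k = 0 then 0 else
     complex_of_real (knorm k powr (2 * s) / (knorm k powr (2 * s) + a)\<^sup>2) * gh k)"

definition dS_aa :: "(int ^ 'd \<Rightarrow> complex) \<Rightarrow> real \<Rightarrow> real \<Rightarrow> int ^ 'd \<Rightarrow> complex" where
  "dS_aa gh s a k = (if k = 0 then 0 else
     complex_of_real (- 2 * knorm k powr (2 * s) / (knorm k powr (2 * s) + a) ^ 3) * gh k)"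

definition dS_as :: "(int ^ 'd \<Rightarrow> complex) \<Rightarrow> real \<Rightarrow> real \<Rightarrow> int ^ 'd \<Rightarrow> complex" where
  "dS_as gh s a k = (if k = 0 then 0 else
     complex_of_real (- 2 * knorm k powr (2 * s) * ln (knorm k) * (knorm k powr (2 * s) - a)
                      / (knorm k powr (2 * s) + a) ^ 3) * gh k)"

definition DS :: "(int ^ 'd \<Rightarrow> complex) \<Rightarrow> real \<times> real \<Rightarrow> real \<times> real \<Rightarrow> int ^ 'd \<Rightarrow> complex" where
  "DS gh = (\<lambda>(s, a) (h1, h2) k.
     complex_of_real h1 * dS_s gh s a k + complex_of_real h2 * dS_a gh s a k)"

definition D2S :: "(int ^ 'd \<Rightarrow> complex) \<Rightarrow> real \<times> real \<Rightarrow> real \<times> real \<Rightarrow> real \<times> real \<Rightarrow> int ^ 'd \<Rightarrow> complex" where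
  "D2S gh = (\<lambda>(s, a) (h1, h2) (l1, l2) k.
     complex_of_real (h1 * l1) * dS_ss gh s a k
     + complex_of_real (h1 * l2 + h2 * l1) * dS_as gh s a k
     + complex_of_real (h2 * l2) * dS_aa gh s a k)"

end

theory Submission
  imports Defs
begin

text \<open>By Bessel's inequality the Fourier coefficients of \<open>g\<close> are square summable, so the solution map
  is the action of a family of Fourier multipliers on a fixed element of \<open>\<ell>\<^sup>2\<close>. With
  \<open>y = |k|\<^bsup>2s\<^esup> \<ge> 1\<close> one has \<open>ln |k| \<le> y / s\<close> and \<open>(ln |k|)\<^sup>2 \<le> y / s\<^sup>2\<close>, and each derivative of
  \<open>\<alpha> / (\<alpha> + y)\<close> in \<open>s\<close> costs one logarithm while the quotient still decays like \<open>1 / y\<close>. Hence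
  all partial derivatives up to order two are bounded uniformly in \<open>k\<close>, and pointwise
  differentiability of the multipliers passes to \<open>\<ell>\<^sup>2\<close> by dominated convergence.\<close>

section \<open>Fourier coefficients of square integrable functions\<close>

text \<open>On a finite measure space this makes \<open>1 + (cmod (f x))\<^sup>2\<close> an
  integrable majorant of a square integrable \<open>f\<close>.\<close>

lemma self_le_one_plus_square: "x \<le> 1 + x\<^sup>2" for x :: real
  using zero_le_power2[of "x - 1 / 2"] by (simp add: power2_eq_square algebra_simps)

text \<open>The nonnegative integral of |V f - P|^2, with P the sum of the c_k phi_k over A, expands
  to V (V F - S), where F is the integral of |f|^2 and S the sum of the |c_k|^2. The factor V enters
  because the phi_k have squared norm V instead of 1.\<close>

lemma bessel_inequality:
  fixes f :: "'a \<Rightarrow> complex" and \<phi> :: "'i \<Rightarrow> 'a \<Rightarrow> complex"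
  assumes M: "finite_measure M" and f: "f \<in> borel_measurable M"
    and f2: "integrable M (\<lambda>x. (cmod (f x))\<^sup>2)"
    and \<phi>[measurable]: "\<And>k. \<phi> k \<in> borel_measurable M" and \<phi>1: "\<And>k x. cmod (\<phi> k x) \<le> 1"
    and orth: "\<And>k l. (\<integral>x. \<phi> k x * cnj (\<phi> l x) \<partial>M) = (if k = l then complex_of_real V else 0)"
    and V: "0 < V" and A: "finite A"
  shows "(\<Sum>k\<in>A. (cmod (\<integral>x. f x * cnj (\<phi> k x) \<partial>M))\<^sup>2) \<le> V * (\<integral>x. (cmod (f x))\<^sup>2 \<partial>M)"
proof -
  interpret finite_measure M by fact
  note f[measurable]
  have cnj\<phi>[measurable]: "(\<lambda>x. cnj (\<phi> k x)) \<in> borel_measurable M" for k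
    by (rule borel_measurable_continuous_on[OF _ \<phi>]) (intro continuous_intros)
  define c where "c k = (\<integral>x. f x * cnj (\<phi> k x) \<partial>M)" for k
  define P where "P x = (\<Sum>k\<in>A. c k * \<phi> k x)" for x
  define S where "S = (\<Sum>k\<in>A. (cmod (c k))\<^sup>2)"
  define F where "F = (\<integral>x. (cmod (f x))\<^sup>2 \<partial>M)"
  have if1: "integrable M f"
  proof (rule Bochner_Integration.integrable_bound[where f = "\<lambda>x. 1 + (cmod (f x))\<^sup>2"])
    show "integrable M (\<lambda>x. 1 + (cmod (f x))\<^sup>2)" using f2 by simp
    show "AE x in M. norm (f x) \<le> norm (1 + (cmod (f x))\<^sup>2)"
      by (auto intro!: AE_I2 self_le_one_plus_square)
  qed (use f in auto)
  have if\<phi>: "integrable M (\<lambda>x. f x * cnj (\<phi> k x))" for k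
    by (rule Bochner_Integration.integrable_bound[OF if1])
      (use \<phi>1 in \<open>auto intro!: AE_I2 mult_left_le simp: norm_mult\<close>)
  have i\<phi>\<phi>: "integrable M (\<lambda>x. \<phi> k x * cnj (\<phi> l x))" for k l
    by (rule integrable_const_bound[where B=1])
      (use \<phi>1 in \<open>auto intro!: AE_I2 mult_le_one simp: norm_mult\<close>)
  have iff: "integrable M (\<lambda>x. f x * cnj (f x))"
    using integrable_of_real[OF f2, where 'a=complex] by (simp only: complex_norm_square)
  have fP: "(\<lambda>x. f x * cnj (P x)) = (\<lambda>x. \<Sum>k\<in>A. cnj (c k) * (f x * cnj (\<phi> k x)))"
    by (auto simp: P_def sum_distrib_left mult_ac)
  have PP: "(\<lambda>x. P x * cnj (P x)) = (\<lambda>x. \<Sum>k\<in>A. \<Sum>l\<in>A. c k * cnj (c l) * (\<phi> k x * cnj (\<phi> l x)))"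
    by (auto simp: P_def sum_product mult_ac)
  have ifP: "integrable M (\<lambda>x. f x * cnj (P x))" unfolding fP
    by (intro Bochner_Integration.integrable_sum integrable_mult_right if\<phi>)
  have iPf: "integrable M (\<lambda>x. P x * cnj (f x))"
    using complex_integrable_cnj[THEN iffD2, OF ifP] by (simp add: mult.commute)
  have iPP: "integrable M (\<lambda>x. P x * cnj (P x))" unfolding PP
    by (intro Bochner_Integration.integrable_sum integrable_mult_right i\<phi>\<phi>)
  have S: "complex_of_real S = (\<Sum>k\<in>A. c k * cnj (c k))"
    by (simp only: S_def of_real_sum complex_norm_square)
  have I1: "(\<integral>x. f x * cnj (P x) \<partial>M) = complex_of_real S"
    unfolding fP by (simp add: if\<phi> c_def[symmetric] S mult.commute)
  have I2: "(\<integral>x. P x * cnj (f x) \<partial>M) = complex_of_real S"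
    using Bochner_Integration.integral_cnj[of M "\<lambda>x. f x * cnj (P x)"] I1 by (simp add: mult.commute)
  have I3: "(\<integral>x. P x * cnj (P x) \<partial>M) = complex_of_real (V * S)"
    unfolding PP by (simp add: i\<phi>\<phi> orth if_distrib[of "\<lambda>x. _ * x"] sum.delta' A S
       sum_distrib_left mult_ac cong: if_cong)
  have I4: "(\<integral>x. f x * cnj (f x) \<partial>M) = complex_of_real F"
    unfolding F_def integral_complex_of_real[symmetric] by (simp only: complex_norm_square)
  \<comment> \<open>\<open>P\<close> is \<open>V\<close> times the orthogonal projection of
    \<open>f\<close>, so \<open>?G\<close> is \<open>V\<close> times the residual.\<close>
  let ?G = "\<lambda>x. complex_of_real V * f x - P x"
  have "complex_of_real (\<integral>x. (cmod (?G x))\<^sup>2 \<partial>M) = (\<integral>x. ?G x * cnj (?G x) \<partial>M)"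
    unfolding integral_complex_of_real[symmetric] by (simp only: complex_norm_square)
  also have "\<dots> = (\<integral>x. (complex_of_real (V\<^sup>2) * (f x * cnj (f x)) - complex_of_real V * (f x * cnj (P x)))
      - (complex_of_real V * (P x * cnj (f x)) - P x * cnj (P x)) \<partial>M)"
    by (intro Bochner_Integration.integral_cong) (auto simp: algebra_simps power2_eq_square)
  also have "\<dots> = complex_of_real (V\<^sup>2 * F - V * S - (V * S - V * S))"
    using iff ifP iPf iPP by (simp add: I1 I2 I3 I4)
  finally have "(\<integral>x. (cmod (?G x))\<^sup>2 \<partial>M) = V * (V * F - S)"
    unfolding of_real_eq_iff by (simp add: power2_eq_square algebra_simps)
  moreover have "0 \<le> (\<integral>x. (cmod (?G x))\<^sup>2 \<partial>M)" by simp
  ultimately have "0 \<le> V * F - S" using V by (simp add: zero_le_mult_iff)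
  then show ?thesis by (simp add: S_def F_def c_def)
qed

section \<open>Orthogonality of the characters\<close>

lemma integral_character_circle:
  fixes n :: int
  shows "set_integrable lborel {0..2*pi} (\<lambda>t. exp (\<i> * complex_of_real (real_of_int n * t)))"
    and "(LBINT t:{0..2*pi}. exp (\<i> * complex_of_real (real_of_int n * t))) = (if n = 0 then 2 * pi else 0)"
proof -
  let ?f = "\<lambda>t. exp (\<i> * complex_of_real (real_of_int n * t))"
  show i: "set_integrable lborel {0..2*pi} ?f"
    by (intro borel_integrable_atLeastAtMost' continuous_intros)
  show "(LBINT t:{0..2*pi}. ?f t) = (if n = 0 then 2 * pi else 0)"
  proof (cases "n = 0")
    case True
    then show ?thesis by (simp add: set_lebesgue_integral_def scaleR_conv_of_real)
  next
    case False
    \<comment> \<open>This primitive has period \<open>2 * pi\<close> because \<open>n\<close> is an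
      integer, so its increment over the interval vanishes.\<close>
    let ?F = "\<lambda>t. ?f t / (\<i> * complex_of_int n)"
    have "(?f has_integral ?F (2*pi) - ?F 0) {0..2*pi}"
    proof (rule fundamental_theorem_of_calculus)
      show "(?F has_vector_derivative ?f t) (at t within {0..2*pi})" for t
      proof -
        \<comment> \<open>The primitive is differentiated as a holomorphic function and then
          restricted to the real line.\<close>
        let ?H = "\<lambda>z. exp (\<i> * of_int n * z) / (\<i> * of_int n)"
        have "(?H has_field_derivative exp (\<i> * of_int n * complex_of_real t)) (at (complex_of_real t))"
          using False by (auto intro!: derivative_eq_intros)
        from has_vector_derivative_real_field[OF this] show ?thesis by (simp add: mult.assoc)
      qed
    qed simp
    moreover have "?f (2*pi) = 1"
      using exp_integer_2pi[of n] by (simp add: mult_ac)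
    ultimately have "(?f has_integral 0) {0..2*pi}" by simp
    then show ?thesis using False set_borel_integral_eq_integral(2)[OF i] by (simp add: integral_unique)
  qed
qed

text \<open>\<open>lborel\<close> is the image of the product of one-dimensional Lebesgue measures
  under the coordinate map, so Fubini splits the integral.\<close>

lemma integral_lborel_prod:
  fixes f :: "'a::euclidean_space \<Rightarrow> real \<Rightarrow> complex"
  assumes "\<And>b. b \<in> Basis \<Longrightarrow> integrable lborel (f b)"
  shows "(\<integral>x. (\<Prod>b\<in>Basis. f b (x \<bullet> b)) \<partial>lborel) = (\<Prod>b\<in>Basis. integral\<^sup>L lborel (f b))"
proof -
  interpret product_sigma_finite "\<lambda>_::'a. lborel :: real measure" ..
  have [measurable]: "f b \<in> borel_measurable borel" if "b \<in> Basis" for b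
    using borel_measurable_integrable[OF assms[OF that]] by simp
  have "(\<integral>x. (\<Prod>b\<in>Basis. f b (x \<bullet> b)) \<partial>lborel)
      = (\<integral>x. (\<Prod>b\<in>Basis. f b ((\<Sum>j\<in>Basis. x j *\<^sub>R j) \<bullet> b)) \<partial>Pi\<^sub>M Basis (\<lambda>_. lborel))"
    by (subst lborel_eq) (rule integral_distr, measurable)
  also have "\<dots> = (\<integral>x. (\<Prod>b\<in>Basis. f b (x b)) \<partial>Pi\<^sub>M Basis (\<lambda>_. lborel))"
    by (intro Bochner_Integration.integral_cong prod.cong refl) simp
  also have "\<dots> = (\<Prod>b\<in>Basis. integral\<^sup>L lborel (f b))"
    by (rule product_integral_prod) (use assms in auto)
  finally show ?thesis .
qed

lemma cell_measurable [measurable]: "cell \<in> sets borel"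
  by (simp add: cell_def)

lemma kdot_inner: "kdot k x = (\<chi> i. real_of_int (k $ i)) \<bullet> x"
  by (simp add: kdot_def inner_vec_def)

lemma continuous_on_kdot [continuous_intros]: "continuous_on S (kdot k)"
  unfolding kdot_def by (intro continuous_intros)

lemma kdot_diff: "kdot (k - l) x = kdot k x - kdot l x"
  by (simp add: kdot_def left_diff_distrib sum_subtractf)

lemma character_measurable [measurable]:
  "(\<lambda>x. exp (\<i> * complex_of_real (kdot k x))) \<in> borel_measurable borel"
  by (intro borel_measurable_continuous_onI continuous_intros)

text \<open>Both the indicator of the cell and the character factor over the coordinates. A nonzero
  component of \<open>k\<close> contributes a vanishing factor.\<close>

lemma integral_character_torus:
  fixes k :: "int ^ 'd"
  shows "(\<integral>x. exp (\<i> * complex_of_real (kdot k x)) \<partial>lebesgue_on cell)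
    = (if k = 0 then complex_of_real ((2 * pi) ^ CARD('d)) else 0)"
proof -
  let ?v = "\<chi> i. real_of_int (k $ i)"
  let ?g = "\<lambda>(b::real^'d) t. indicator {0..2*pi} t *\<^sub>R exp (\<i> * complex_of_real ((?v \<bullet> b) * t))"
  have vb: "\<exists>n::int. ?v \<bullet> b = n" if "b \<in> Basis" for b
    using that by (auto simp: Basis_vec_def inner_axis)
  have cell: "indicator cell x = (\<Prod>b\<in>Basis. indicator {0..2*pi} (x \<bullet> b) :: real)" for x :: "real^'d"
  proof -
    have "(\<Prod>b\<in>Basis. indicator {0..2*pi} (x \<bullet> b)) = (if \<forall>b\<in>Basis. x \<bullet> b \<in> {0..2*pi} then 1 else 0 :: real)"
      by (auto simp: prod_zero_iff indicator_def intro!: prod.neutral)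
    moreover have "x \<in> cell \<longleftrightarrow> (\<forall>b\<in>Basis. x \<bullet> b \<in> {0..2*pi})"
      by (auto simp: cell_def mem_box Basis_vec_def inner_axis)
    ultimately show ?thesis by (simp add: indicator_def)
  qed
  have pw: "indicator cell x *\<^sub>R exp (\<i> * complex_of_real (kdot k x)) = (\<Prod>b\<in>Basis. ?g b (x \<bullet> b))"
    for x :: "real^'d"
  proof -
    have "\<i> * complex_of_real (kdot k x) = (\<Sum>b\<in>Basis. \<i> * complex_of_real ((?v \<bullet> b) * (x \<bullet> b)))"
      by (simp add: kdot_inner euclidean_inner[of ?v x] sum_distrib_left)
    then show ?thesis by (simp add: exp_sum cell scaleR_conv_of_real prod.distrib)
  qed
  have g: "integrable lborel (?g b)" "integral\<^sup>L lborel (?g b) = (if ?v \<bullet> b = 0 then 2 * pi else 0)"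
    if b: "b \<in> Basis" for b
  proof -
    obtain n :: int where "?v \<bullet> b = n" using vb[OF b] by blast
    with integral_character_circle[of n] show "integrable lborel (?g b)"
      "integral\<^sup>L lborel (?g b) = (if ?v \<bullet> b = 0 then 2 * pi else 0)"
      by (simp_all add: set_integrable_def set_lebesgue_integral_def)
  qed
  have "(\<integral>x. exp (\<i> * complex_of_real (kdot k x)) \<partial>lebesgue_on cell)
      = (\<integral>x. indicator cell x *\<^sub>R exp (\<i> * complex_of_real (kdot k x)) \<partial>lebesgue)"
    by (rule integral_restrict_space) (simp add: cell_def)
  \<comment> \<open>The integrand is Borel measurable, so completing the measure leaves its integral
    unchanged; the product formula is stated for \<open>lborel\<close>.\<close>
  also have "\<dots> = (\<integral>x. indicator cell x *\<^sub>R exp (\<i> * complex_of_real (kdot k x)) \<partial>lborel)"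
    by (rule integral_completion) measurable
  also have "\<dots> = (\<Prod>b\<in>Basis. integral\<^sup>L lborel (?g b))"
    unfolding pw by (rule integral_lborel_prod) (rule g)
  also have "\<dots> = (\<Prod>b\<in>(Basis :: (real^'d) set). if ?v \<bullet> b = 0 then complex_of_real (2 * pi) else 0)"
    by (rule prod.cong) (use g in auto)
  also have "\<dots> = (if k = 0 then complex_of_real ((2 * pi) ^ CARD('d)) else 0)"
  proof (cases "k = 0")
    case True
    then have "?v = 0" by (simp add: vec_eq_iff)
    with True show ?thesis by simp
  next
    case False
    then obtain i where "k $ i \<noteq> 0" by (auto simp: vec_eq_iff)
    then have "\<exists>b\<in>Basis. ?v \<bullet> b \<noteq> 0"
      by (intro bexI[of _ "axis i 1"]) (auto simp: inner_axis)
    with False show ?thesis by (auto simp: prod_zero_iff)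
  qed
  finally show ?thesis .
qed

text \<open>Bessel's inequality bounds all finite sums of squared coefficients by one constant, and
  nonnegative terms with bounded finite sums are summable.\<close>

lemma fourier_coeff_in_l2:
  fixes g :: "real ^ 'd \<Rightarrow> complex"
  assumes "L2_0_torus g"
  shows "in_l2 (fourier_coeff g)"
proof -
  let ?M = "lebesgue_on (cell :: (real^'d) set)"
  let ?\<phi> = "\<lambda>(k::int^'d) x. exp (\<i> * complex_of_real (kdot k x))"
  have cl: "(cell :: (real^'d) set) \<in> sets lebesgue" by (simp add: cell_def)
  have M: "finite_measure ?M" by (rule finite_measure_lebesgue_on) (simp add: cell_def)
  then interpret finite_measure ?M .
  have gm[measurable]: "g \<in> borel_measurable ?M"
    using assms cl by (simp add: L2_0_torus_def measurable_on_iff_borel_measurable)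
  \<comment> \<open>The assumption is gauge integrability; for a nonnegative function it yields
    Lebesgue integrability.\<close>
  have g2: "integrable ?M (\<lambda>x. (cmod (g x))\<^sup>2)"
    using assms cl by (auto simp: L2_0_torus_def intro!: absolutely_integrable_imp_integrable nonnegative_absolutely_integrable_1)
  have \<phi>m[measurable]: "?\<phi> k \<in> borel_measurable ?M" for k
    by (rule measurable_restrict_space1) (simp add: measurable_completion)
  have orth: "(\<integral>x. ?\<phi> k x * cnj (?\<phi> l x) \<partial>?M) = (if k = l then complex_of_real ((2 * pi) ^ CARD('d)) else 0)" for k l
  proof -
    have "?\<phi> k x * cnj (?\<phi> l x) = ?\<phi> (k - l) x" for x
      by (simp add: exp_cnj exp_add[symmetric] kdot_diff right_diff_distrib)
    then show ?thesis using integral_character_torus[of "k - l"] by simp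
  qed
  \<comment> \<open>The coefficients are gauge integrals, while Bessel's inequality concerns
    Lebesgue integrals; the two agree once the product is Lebesgue integrable.\<close>
  have coeff: "fourier_coeff g k = (\<integral>x. g x * cnj (?\<phi> k x) \<partial>?M)" for k
  proof -
    have "integrable ?M (\<lambda>x. g x * cnj (?\<phi> k x))"
    proof (rule Bochner_Integration.integrable_bound[where f = "\<lambda>x. 1 + (cmod (g x))\<^sup>2"])
      show "integrable ?M (\<lambda>x. 1 + (cmod (g x))\<^sup>2)" using g2 by simp
      show "AE x in ?M. norm (g x * cnj (?\<phi> k x)) \<le> norm (1 + (cmod (g x))\<^sup>2)"
        by (auto intro!: AE_I2 self_le_one_plus_square simp: norm_mult)
    next
      have "(\<lambda>x. cnj (?\<phi> k x)) \<in> borel_measurable ?M"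
        by (rule borel_measurable_continuous_on[OF _ \<phi>m]) (intro continuous_intros)
      then show "(\<lambda>x. g x * cnj (?\<phi> k x)) \<in> borel_measurable ?M" by measurable
    qed
    from lebesgue_integral_eq_integral[OF this cl] show ?thesis
      by (simp add: fourier_coeff_def exp_cnj)
  qed
  have "(\<Sum>k\<in>A. (cmod (fourier_coeff g k))\<^sup>2) \<le> (2 * pi) ^ CARD('d) * (\<integral>x. (cmod (g x))\<^sup>2 \<partial>?M)"
    if "finite A" for A
    unfolding coeff by (rule bessel_inequality[OF M gm g2 \<phi>m _ orth _ that]) auto
  then show ?thesis
    unfolding in_l2_def by (intro nonneg_bdd_above_summable_on bdd_aboveI2) auto
qed

text \<open>At frequency zero the character is constantly 1, so this is the zero mean
  condition.\<close>

lemma fourier_coeff_zero: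
  assumes "L2_0_torus g"
  shows "fourier_coeff g 0 = 0"
  using assms by (simp add: L2_0_torus_def fourier_coeff_def kdot_def)

section \<open>Multipliers on square summable families\<close>

lemma l2norm_nonneg: "0 \<le> l2norm x"
  by (simp add: l2norm_def infsum_nonneg)

lemma l2norm_square: "(l2norm x)\<^sup>2 = (\<Sum>\<^sub>\<infinity>k. (cmod (x k))\<^sup>2)"
  by (simp add: l2norm_def infsum_nonneg)

text \<open>Comparison of the squared series. In particular a multiplier bounded by \<open>B\<close>
  acts on square summable families with norm at most \<open>B\<close>.\<close>

lemma l2_dominated:
  assumes "in_l2 c" and "0 \<le> B" and "\<And>k. cmod (x k) \<le> B * cmod (c k)"
  shows "in_l2 x" and "l2norm x \<le> B * l2norm c"
proof -
  have le: "(cmod (x k))\<^sup>2 \<le> B\<^sup>2 * (cmod (c k))\<^sup>2" for k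
    using power_mono[OF assms(3)[of k], of 2] by (simp add: power_mult_distrib)
  have sm: "(\<lambda>k. B\<^sup>2 * (cmod (c k))\<^sup>2) summable_on UNIV"
    using assms(1) unfolding in_l2_def by (rule summable_on_cmult_right)
  show x: "in_l2 x"
    unfolding in_l2_def by (rule summable_on_comparison_test[OF sm]) (use le in auto)
  have "(l2norm x)\<^sup>2 \<le> (\<Sum>\<^sub>\<infinity>k. B\<^sup>2 * (cmod (c k))\<^sup>2)"
    unfolding l2norm_square by (rule infsum_mono) (use x sm le in \<open>auto simp: in_l2_def\<close>)
  also have "\<dots> = (B * l2norm c)\<^sup>2"
    by (simp add: infsum_cmult_right' l2norm_square power_mult_distrib)
  finally show "l2norm x \<le> B * l2norm c"
    using assms(2) l2norm_nonneg by (meson mult_nonneg_nonneg power2_le_imp_le)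
qed

text \<open>Cauchy-Schwarz in the plane at each index, followed by a^2 + b^2 \<le> (a + b)^2 for a,
  b \<ge> 0. The bound is uniform for \<open>(h1, h2)\<close> in the unit ball, as an operator norm
  requires.\<close>

lemma l2norm_combination_le:
  assumes X: "in_l2 X" and Y: "in_l2 Y"
  shows "l2norm (\<lambda>k. complex_of_real h1 * X k + complex_of_real h2 * Y k)
    \<le> norm (h1, h2) * (l2norm X + l2norm Y)" (is "l2norm ?Z \<le> _")
proof -
  let ?n = "norm (h1, h2)"
  have n: "?n\<^sup>2 = h1\<^sup>2 + h2\<^sup>2" by (simp add: norm_Pair)
  have le: "(cmod (?Z k))\<^sup>2 \<le> ?n\<^sup>2 * ((cmod (X k))\<^sup>2 + (cmod (Y k))\<^sup>2)" for k
  proof -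
    have "cmod (?Z k) \<le> \<bar>h1\<bar> * cmod (X k) + \<bar>h2\<bar> * cmod (Y k)"
      using norm_triangle_ineq[of "complex_of_real h1 * X k" "complex_of_real h2 * Y k"]
      by (simp add: norm_mult)
    then have "(cmod (?Z k))\<^sup>2 \<le> (\<bar>h1\<bar> * cmod (X k) + \<bar>h2\<bar> * cmod (Y k))\<^sup>2"
      by (rule power_mono) simp
    \<comment> \<open>Lagrange's identity: the two sides differ by the square of
      \<open>\<bar>h1\<bar> * cmod (Y k) - \<bar>h2\<bar> * cmod (X k)\<close>.\<close>
    also have "\<dots> \<le> (h1\<^sup>2 + h2\<^sup>2) * ((cmod (X k))\<^sup>2 + (cmod (Y k))\<^sup>2)"
      using zero_le_power2[of "\<bar>h1\<bar> * cmod (Y k) - \<bar>h2\<bar> * cmod (X k)"]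
      by (simp add: power2_sum power2_diff power_mult_distrib algebra_simps)
    finally show ?thesis using n by simp
  qed
  have sm: "(\<lambda>k. ?n\<^sup>2 * ((cmod (X k))\<^sup>2 + (cmod (Y k))\<^sup>2)) summable_on UNIV"
    using X Y unfolding in_l2_def by (intro summable_on_cmult_right summable_on_add)
  have "(\<lambda>k. (cmod (?Z k))\<^sup>2) summable_on UNIV"
    by (rule summable_on_comparison_test[OF sm]) (use le in auto)
  then have "(l2norm ?Z)\<^sup>2 \<le> (\<Sum>\<^sub>\<infinity>k. ?n\<^sup>2 * ((cmod (X k))\<^sup>2 + (cmod (Y k))\<^sup>2))"
    unfolding l2norm_square by (rule infsum_mono) (use sm le in auto)
  also have "\<dots> = ?n\<^sup>2 * ((l2norm X)\<^sup>2 + (l2norm Y)\<^sup>2)"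
    using X Y by (simp add: infsum_cmult_right' l2norm_square infsum_add in_l2_def)
  also have "\<dots> \<le> (?n * (l2norm X + l2norm Y))\<^sup>2"
    using l2norm_nonneg[of X] l2norm_nonneg[of Y]
    by (simp add: power_mult_distrib power2_sum mult_left_mono)
  finally show ?thesis
    using l2norm_nonneg[of X] l2norm_nonneg[of Y] by (meson add_nonneg_nonneg mult_nonneg_nonneg norm_ge_zero power2_le_imp_le)
qed

text \<open>The zero vector keeps the set under the real \<open>Sup\<close> nonempty, so the
  supremum lies below every upper bound.\<close>

lemma l2opnorm_le:
  assumes "\<And>h. norm h \<le> 1 \<Longrightarrow> l2norm (T h) \<le> C"
  shows "l2opnorm T \<le> C"
  unfolding l2opnorm_def
proof (rule cSup_least)
  show "(\<lambda>h. l2norm (T h)) ` {h. norm h \<le> 1} \<noteq> {}" by (auto intro: exI[of _ 0])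
qed (use assms in auto)

text \<open>The finite partial sums converge to the total; a partial sum within \<open>e\<close> of
  it leaves a tail below \<open>e\<close>.\<close>

lemma in_l2_tail:
  assumes c: "in_l2 c" and e: "0 < e"
  obtains A where "finite A" and "(\<Sum>\<^sub>\<infinity>k\<in>-A. (cmod (c k))\<^sup>2) < e"
proof -
  let ?f = "\<lambda>k. (cmod (c k))\<^sup>2"
  have sm: "?f summable_on UNIV" using c by (simp add: in_l2_def)
  then have "(sum ?f \<longlongrightarrow> infsum ?f UNIV) (finite_subsets_at_top UNIV)"
    by (rule infsum_tendsto)
  then have "\<forall>\<^sub>F A in finite_subsets_at_top UNIV. dist (sum ?f A) (infsum ?f UNIV) < e"
    using e by (rule tendstoD)
  then obtain A where A: "finite A" "dist (sum ?f A) (infsum ?f UNIV) < e"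
    unfolding eventually_finite_subsets_at_top by blast
  have "infsum ?f UNIV = infsum ?f A + infsum ?f (-A)"
    using infsum_Un_disjoint[of ?f A "-A"] A(1) summable_on_subset_banach[OF sm]
    by (simp add: Compl_partition)
  with A have "infsum ?f (-A) < e" by (auto simp: dist_real_def)
  with A(1) that show ?thesis by blast
qed

text \<open>The pointwise derivative is used only at the finitely many indices outside a small tail of
  \<open>c\<close>; on the tail the uniform Lipschitz bound suffices. A Taylor estimate uniform in \<open>k\<close> would
  need bounds on one more derivative of \<open>m\<close>.\<close>

lemma l2_multiplier_remainder:
  fixes m :: "'i \<Rightarrow> 'a::real_normed_vector \<Rightarrow> real"
  assumes c: "in_l2 c" and W: "convex W" and p: "p \<in> W" and B: "0 \<le> B"
    and der: "\<And>k q. q \<in> W \<Longrightarrow> (m k has_derivative m' k q) (at q within W)"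
    and bd: "\<And>k q h. q \<in> W \<Longrightarrow> \<bar>m' k q h\<bar> \<le> B * norm h"
    and e: "0 < e"
  shows "\<exists>\<delta>>0. \<forall>q\<in>W. norm (q - p) < \<delta> \<longrightarrow>
    in_l2 (\<lambda>k. complex_of_real (m k q - m k p - m' k p (q - p)) * c k) \<and>
    l2norm (\<lambda>k. complex_of_real (m k q - m k p - m' k p (q - p)) * c k) \<le> e * norm (q - p)"
proof -
  let ?f = "\<lambda>k. (cmod (c k))\<^sup>2"
  let ?r = "\<lambda>q k. m k q - m k p - m' k p (q - p)"
  define N where "N = infsum ?f UNIV"
  \<comment> \<open>Chosen so that the indices in the finite set contribute at most e^2 / 2; the
    summand 1 keeps the denominator nonzero when \<open>c\<close> vanishes.\<close>
  define e' where "e' = e / sqrt (2 * (N + 1))"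
  have sm: "?f summable_on UNIV" using c by (simp add: in_l2_def)
  have N: "0 \<le> N" by (simp add: N_def infsum_nonneg)
  have e': "0 < e'" "e'\<^sup>2 * N \<le> e\<^sup>2 / 2"
    using e N by (simp_all add: e'_def power_divide field_simps)
  \<comment> \<open>One \<open>B\<close> comes from the mean value inequality on the convex set
    \<open>W\<close>, the other from the derivative at \<open>p\<close>.\<close>
  have lip: "\<bar>?r q k\<bar> \<le> 2 * B * norm (q - p)" if "q \<in> W" for q k
  proof -
    have "norm (m k q - m k p) \<le> B * norm (q - p)"
    proof (rule differentiable_bound[OF W der _ that p])
      show "onorm (m' k x) \<le> B" if "x \<in> W" for x
        using bd[OF that] B by (intro onorm_bound) auto
    qed
    with bd[OF p, of k "q - p"] show ?thesis by simp
  qed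
  \<comment> \<open>A tail below this size, weighted by (2 B)^2, contributes at most e^2 / 2; the
    summand 1 covers \<open>B = 0\<close>.\<close>
  have "0 < e\<^sup>2 / (2 * ((2 * B)\<^sup>2 + 1))" using e by (intro divide_pos_pos) (auto intro: add_nonneg_pos)
  then obtain A where A: "finite A" "infsum ?f (-A) < e\<^sup>2 / (2 * ((2 * B)\<^sup>2 + 1))"
    using in_l2_tail[OF c] by blast
  have "\<forall>k. \<exists>d>0. \<forall>q\<in>W. norm (q - p) < d \<longrightarrow> \<bar>?r q k\<bar> \<le> e' * norm (q - p)"
    using der[OF p] e'(1) unfolding has_derivative_within_alt real_norm_def by blast
  then obtain d where d: "\<And>k. 0 < d k"
    "\<And>k q. q \<in> W \<Longrightarrow> norm (q - p) < d k \<Longrightarrow> \<bar>?r q k\<bar> \<le> e' * norm (q - p)" by metis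
  \<comment> \<open>The inserted 1 keeps the minimum meaningful when \<open>A\<close> is
    empty.\<close>
  define \<delta> where "\<delta> = Min (insert 1 (d ` A))"
  have \<delta>: "0 < \<delta>" "\<And>k. k \<in> A \<Longrightarrow> \<delta> \<le> d k" using A(1) d(1) by (auto simp: \<delta>_def)
  \<comment> \<open>These weights bound the remainder quotients both on \<open>A\<close> and on the
    tail. All \<open>q\<close> near \<open>p\<close> are thus handled by one fixed sequence
    \<open>c'\<close> of norm at most \<open>e\<close>.\<close>
  define w where "w k = (if k \<in> A then e' else 2 * B)" for k
  have w0: "0 \<le> w k" for k using e' B by (simp add: w_def)
  have Bt: "(2 * B)\<^sup>2 * infsum ?f (-A) \<le> e\<^sup>2 / 2"
  proof -
    have "(2 * B)\<^sup>2 * infsum ?f (-A) \<le> ((2 * B)\<^sup>2 + 1) * infsum ?f (-A)"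
      by (intro mult_right_mono infsum_nonneg) auto
    also have "\<dots> \<le> ((2 * B)\<^sup>2 + 1) * (e\<^sup>2 / (2 * ((2 * B)\<^sup>2 + 1)))"
      using A(2) by (intro mult_left_mono) auto
    also have "\<dots> = e\<^sup>2 / 2"
    proof -
      have "(2 * B)\<^sup>2 + 1 \<noteq> 0" by (metis add_nonneg_pos less_numeral_extra(1,3) zero_le_power2)
      then show ?thesis by (metis mult.commute nonzero_mult_divide_mult_cancel_left times_divide_eq_right)
    qed
    finally show ?thesis .
  qed
  have smA: "?f summable_on T" for T using summable_on_subset_banach[OF sm] by simp
  define c' where "c' k = complex_of_real (w k) * c k" for k
  have c'2: "(cmod (c' k))\<^sup>2 = (w k)\<^sup>2 * ?f k" for k
    by (simp add: c'_def norm_mult power_mult_distrib)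
  have c': "in_l2 c'"
    by (rule l2_dominated(1)[OF c, of "max e' (2*B)"]) (use e' B w0 in \<open>auto simp: c'_def norm_mult w_def intro!: mult_right_mono\<close>)
  have "(l2norm c')\<^sup>2 = (\<Sum>\<^sub>\<infinity>k\<in>A \<union> -A. (w k)\<^sup>2 * ?f k)"
    by (simp add: l2norm_square c'2 Compl_partition)
  also have "\<dots> = (\<Sum>\<^sub>\<infinity>k\<in>A. (w k)\<^sup>2 * ?f k) + (\<Sum>\<^sub>\<infinity>k\<in>-A. (w k)\<^sup>2 * ?f k)"
  proof (rule infsum_Un_disjoint)
    have "(\<lambda>k. (w k)\<^sup>2 * ?f k) summable_on UNIV" using c' by (simp add: in_l2_def c'2)
    then show "(\<lambda>k. (w k)\<^sup>2 * ?f k) summable_on A" "(\<lambda>k. (w k)\<^sup>2 * ?f k) summable_on -A"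
      by (auto intro: summable_on_subset_banach)
  qed auto
  also have "(\<Sum>\<^sub>\<infinity>k\<in>A. (w k)\<^sup>2 * ?f k) = e'\<^sup>2 * infsum ?f A"
    by (subst infsum_cmult_right'[symmetric], rule infsum_cong) (simp add: w_def)
  also have "(\<Sum>\<^sub>\<infinity>k\<in>-A. (w k)\<^sup>2 * ?f k) = (2 * B)\<^sup>2 * infsum ?f (-A)"
    by (subst infsum_cmult_right'[symmetric], rule infsum_cong) (simp add: w_def)
  also have "e'\<^sup>2 * infsum ?f A \<le> e'\<^sup>2 * N"
    unfolding N_def by (intro mult_left_mono infsum_mono_neutral smA) auto
  finally have "(l2norm c')\<^sup>2 \<le> e\<^sup>2" using e'(2) Bt by simp
  then have nc': "l2norm c' \<le> e" using e by (meson less_eq_real_def power2_le_imp_le)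
  show ?thesis
  proof (intro exI[of _ \<delta>] conjI ballI impI \<delta>(1))
    fix q assume q: "q \<in> W" "norm (q - p) < \<delta>"
    have le: "cmod (complex_of_real (?r q k) * c k) \<le> norm (q - p) * cmod (c' k)" for k
    proof -
      have "\<bar>?r q k\<bar> \<le> w k * norm (q - p)"
        using lip[OF q(1), of k] d(2)[OF q(1), of k] \<delta>(2)[of k] q(2) by (auto simp: w_def)
      then have "\<bar>?r q k\<bar> * cmod (c k) \<le> w k * norm (q - p) * cmod (c k)"
        by (rule mult_right_mono) simp
      then show ?thesis using w0[of k] by (simp add: norm_mult c'_def mult_ac del: of_real_diff)
    qed
    show "in_l2 (\<lambda>k. complex_of_real (?r q k) * c k)"
      by (rule l2_dominated(1)[OF c' norm_ge_zero le])
    have "l2norm (\<lambda>k. complex_of_real (?r q k) * c k) \<le> norm (q - p) * l2norm c'"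
      by (rule l2_dominated(2)[OF c' norm_ge_zero le])
    also have "\<dots> \<le> norm (q - p) * e" using nc' by (rule mult_left_mono) simp
    finally show "l2norm (\<lambda>k. complex_of_real (?r q k) * c k) \<le> e * norm (q - p)"
      by (simp add: mult.commute)
  qed
qed

section \<open>The symbol of the solution map\<close>

text \<open>\<open>symb r (s, \<alpha>)\<close> is the Fourier multiplier of the solution map at \<open>|k| = r\<close>; the suffixes denote
  its partial derivatives.\<close>

definition symb :: "real \<Rightarrow> real \<times> real \<Rightarrow> real" where
  "symb r p = snd p / (snd p + r powr (2 * fst p))"

definition symb_s :: "real \<Rightarrow> real \<times> real \<Rightarrow> real" where
  "symb_s r p = - (2 * snd p * r powr (2 * fst p) * ln r) / (r powr (2 * fst p) + snd p)\<^sup>2"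

definition symb_a :: "real \<Rightarrow> real \<times> real \<Rightarrow> real" where
  "symb_a r p = r powr (2 * fst p) / (r powr (2 * fst p) + snd p)\<^sup>2"

definition symb_ss :: "real \<Rightarrow> real \<times> real \<Rightarrow> real" where
  "symb_ss r p = 4 * snd p * r powr (2 * fst p) * (ln r)\<^sup>2 * (r powr (2 * fst p) - snd p)
    / (snd p + r powr (2 * fst p)) ^ 3"

definition symb_as :: "real \<Rightarrow> real \<times> real \<Rightarrow> real" where
  "symb_as r p = - 2 * r powr (2 * fst p) * ln r * (r powr (2 * fst p) - snd p)
    / (r powr (2 * fst p) + snd p) ^ 3"

definition symb_aa :: "real \<Rightarrow> real \<times> real \<Rightarrow> real" where
  "symb_aa r p = - 2 * r powr (2 * fst p) / (r powr (2 * fst p) + snd p) ^ 3"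

section \<open>Derivatives of the symbol\<close>

lemma powr_fst_has_derivative:
  fixes r :: real
  assumes "0 < r"
  shows "((\<lambda>p. r powr (2 * fst p)) has_derivative (\<lambda>h. 2 * ln r * r powr (2 * fst p) * fst h))
    (at p within W)"
proof -
  have "(\<lambda>p. r powr (2 * fst p)) = (\<lambda>p. exp (2 * fst p * ln r))"
    using assms by (simp add: powr_def)
  then show ?thesis
    using assms by (auto simp: powr_def intro!: derivative_eq_intros)
qed

text \<open>The quotient rule with one factor of \<open>D p\<close> cancelled, which produces the
  cubes in the second derivatives of the symbol.\<close>

lemma has_derivative_divide_square:
  fixes f D :: "'a::real_normed_vector \<Rightarrow> real"
  assumes f: "(f has_derivative f') (at p within W)" and D: "(D has_derivative D') (at p within W)"
    and 0: "D p \<noteq> 0"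
  shows "((\<lambda>q. f q / (D q)\<^sup>2) has_derivative (\<lambda>h. (f' h * D p - 2 * f p * D' h) / (D p) ^ 3))
    (at p within W)"
proof -
  have D2: "((\<lambda>q. (D q)\<^sup>2) has_derivative (\<lambda>h. 2 * D p * D' h)) (at p within W)"
    using has_derivative_power[OF D, of 2] by (simp add: mult_ac)
  have eq: "(x * S\<^sup>2 - y * (2 * S * z)) / (S\<^sup>2 * S\<^sup>2) = (x * S - 2 * y * z) / S ^ 3"
    if "S \<noteq> 0" for x y z S :: real
  proof -
    have "x * S\<^sup>2 - y * (2 * S * z) = S * (x * S - 2 * y * z)" "S\<^sup>2 * S\<^sup>2 = S * S ^ 3"
      by (simp_all add: power2_eq_square power3_eq_cube algebra_simps)
    with that show ?thesis by simp
  qed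
  from 0 have "(D p)\<^sup>2 \<noteq> 0" by simp
  from has_derivative_divide'[OF f D2 this] show ?thesis by (simp only: eq[OF 0])
qed

lemma symb_has_derivative:
  assumes r: "0 < r" and a: "0 < snd p"
  shows "(symb r has_derivative (\<lambda>h. fst h * symb_s r p + snd h * symb_a r p)) (at p within W)"
proof -
  define y where "y = r powr (2 * fst p)"
  have pos: "snd p + y \<noteq> 0" using r a by (simp add: y_def add_pos_pos less_imp_neq[symmetric])
  have D: "((\<lambda>q. snd q + r powr (2 * fst q)) has_derivative (\<lambda>h. snd h + 2 * ln r * y * fst h))
      (at p within W)"
    unfolding y_def by (intro has_derivative_add powr_fst_has_derivative[OF r] has_derivative_snd has_derivative_ident)
  \<comment> \<open>The products \<open>snd p * snd h\<close> cancel, leaving one term for each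
    partial derivative.\<close>
  have num: "snd h * (snd p + y) - snd p * (snd h + 2 * ln r * y * fst h)
      = fst h * (- (2 * snd p * y * ln r)) + snd h * y" for h
    by (simp add: algebra_simps)
  have "(symb r has_derivative (\<lambda>h. (snd h * (snd p + y) - snd p * (snd h + 2 * ln r * y * fst h))
      / ((snd p + y) * (snd p + y)))) (at p within W)"
    unfolding symb_def[abs_def] y_def
    by (rule has_derivative_divide'[OF has_derivative_snd[OF has_derivative_ident] D[unfolded y_def]])
      (use pos in \<open>simp add: y_def\<close>)
  moreover have "(snd h * (snd p + y) - snd p * (snd h + 2 * ln r * y * fst h)) / ((snd p + y) * (snd p + y))
      = fst h * symb_s r p + snd h * symb_a r p" for h
    unfolding num symb_s_def symb_a_def y_def[symmetric]
    by (simp add: add_divide_distrib diff_divide_distrib power2_eq_square add.commute)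
  ultimately show ?thesis by simp
qed

lemma symb_s_has_derivative:
  assumes r: "0 < r" and a: "0 < snd p"
  shows "(symb_s r has_derivative (\<lambda>h. fst h * symb_ss r p + snd h * symb_as r p)) (at p within W)"
proof -
  define y where "y = r powr (2 * fst p)"
  have pos: "y + snd p \<noteq> 0" using r a by (simp add: y_def add_pos_pos less_imp_neq[symmetric])
  note Y = powr_fst_has_derivative[OF r, of p W]
  have b: "((\<lambda>q. snd q) has_derivative (\<lambda>h. snd h)) (at p within W)"
    by (intro has_derivative_snd has_derivative_ident)
  have D: "((\<lambda>q. r powr (2 * fst q) + snd q) has_derivative (\<lambda>h. 2 * ln r * y * fst h + snd h))
      (at p within W)"
    unfolding y_def by (intro has_derivative_add Y b)
  have N: "((\<lambda>q. - (2 * snd q * r powr (2 * fst q) * ln r)) has_derivative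
      (\<lambda>h. - ((2 * snd p * (2 * ln r * y * fst h) + 2 * snd h * y) * ln r))) (at p within W)"
    unfolding y_def
    by (intro has_derivative_minus has_derivative_mult_left has_derivative_mult has_derivative_mult_right Y b)
  \<comment> \<open>The factor \<open>y - snd p\<close> arises as \<open>2 * y - (y + snd p)\<close>
    in the direction of s and as \<open>(y + snd p) - 2 * snd p\<close> in that of \<alpha>.\<close>
  have num: "- ((2 * snd p * (2 * ln r * y * fst h) + 2 * snd h * y) * ln r) * (y + snd p)
      - 2 * (- (2 * snd p * y * ln r)) * (2 * ln r * y * fst h + snd h)
      = fst h * (4 * snd p * y * (ln r)\<^sup>2 * (y - snd p)) + snd h * (- 2 * y * ln r * (y - snd p))" for h
    by (simp add: algebra_simps power2_eq_square)
  have "fst h * symb_ss r p + snd h * symb_as r p = (- ((2 * snd p * (2 * ln r * y * fst h) + 2 * snd h * y) * ln r) * (y + snd p)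
      - 2 * (- (2 * snd p * y * ln r)) * (2 * ln r * y * fst h + snd h)) / (y + snd p) ^ 3" for h
    unfolding num symb_ss_def symb_as_def y_def[symmetric]
    by (simp add: add_divide_distrib diff_divide_distrib add.commute)
  then show ?thesis
    using has_derivative_divide_square[OF N D] pos
    by (simp add: symb_s_def[abs_def] y_def)
qed

text \<open>The mixed coefficient is the same \<open>symb_as\<close> as in the derivative of
  \<open>symb_s\<close>, so the second derivative is symmetric.\<close>

lemma symb_a_has_derivative:
  assumes r: "0 < r" and a: "0 < snd p"
  shows "(symb_a r has_derivative (\<lambda>h. fst h * symb_as r p + snd h * symb_aa r p)) (at p within W)"
proof -
  define y where "y = r powr (2 * fst p)"
  have pos: "y + snd p \<noteq> 0" using r a by (simp add: y_def add_pos_pos less_imp_neq[symmetric])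
  note Y = powr_fst_has_derivative[OF r, of p W]
  have D: "((\<lambda>q. r powr (2 * fst q) + snd q) has_derivative (\<lambda>h. 2 * ln r * y * fst h + snd h))
      (at p within W)"
    unfolding y_def by (intro has_derivative_add Y has_derivative_snd has_derivative_ident)
  have num: "2 * ln r * y * fst h * (y + snd p) - 2 * y * (2 * ln r * y * fst h + snd h)
      = fst h * (- 2 * y * ln r * (y - snd p)) + snd h * (- 2 * y)" for h
    by (simp add: algebra_simps power2_eq_square)
  have "fst h * symb_as r p + snd h * symb_aa r p = (2 * ln r * y * fst h * (y + snd p) - 2 * y * (2 * ln r * y * fst h + snd h)) / (y + snd p) ^ 3" for h
    unfolding num symb_as_def symb_aa_def y_def[symmetric]
    by (simp add: add_divide_distrib diff_divide_distrib add.commute)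
  then show ?thesis
    using has_derivative_divide_square[OF Y D] pos
    by (simp add: symb_a_def[abs_def] y_def)
qed

section \<open>Bounds on the symbol and its derivatives, uniform in the frequency\<close>

context
  fixes r s0 \<alpha>1 :: real and p :: "real \<times> real"
  assumes r: "1 \<le> r" and s0: "0 < s0" "s0 \<le> fst p" and a: "0 < snd p" "snd p \<le> \<alpha>1"
begin

text \<open>With z = r^s one has s0 ln r \<le> ln z \<le> z. Squaring gives the second bound, and z
  \<le> z^2 gives the first.\<close>

lemma ln_le_powr: "ln r \<le> r powr (2 * fst p) / s0" "(ln r)\<^sup>2 \<le> r powr (2 * fst p) / s0\<^sup>2"
proof -
  define z where "z = r powr fst p"
  have z: "1 \<le> z" using r s0 by (simp add: z_def ge_one_powr_ge_zero)
  have z2: "r powr (2 * fst p) = z\<^sup>2" using r by (simp add: z_def power2_eq_square powr_add[symmetric])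
  have L: "0 \<le> ln r" using r by simp
  have "s0 * ln r \<le> fst p * ln r" using s0 L by (intro mult_right_mono)
  also have "\<dots> = ln z" using r by (simp add: z_def ln_powr)
  also have "\<dots> \<le> z" using ln_le_minus_one[of z] z by simp
  finally have *: "s0 * ln r \<le> z" .
  then have "(s0 * ln r)\<^sup>2 \<le> z\<^sup>2" using L s0 by (intro power_mono) auto
  then show "(ln r)\<^sup>2 \<le> r powr (2 * fst p) / s0\<^sup>2"
    unfolding z2 using s0 by (simp add: power_mult_distrib field_simps)
  have "z \<le> z\<^sup>2" using z by (simp add: power2_eq_square)
  with * show "ln r \<le> r powr (2 * fst p) / s0"
    unfolding z2 using s0 by (simp add: field_simps)
qed

text \<open>With y = r^(2s) and b = \<alpha>, the logarithms are absorbed by y (ln r)^i \<le> y^2 /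
  s0^i \<le> (y + b)^2 / s0^i for i = 1, 2, and the remaining quotient |y - b| / (y + b) is at most
  1.\<close>

lemma symb_abs_le:
  "\<bar>symb r p\<bar> \<le> 1"
  "\<bar>symb_s r p\<bar> \<le> 2 * \<alpha>1 / s0" "\<bar>symb_a r p\<bar> \<le> 1"
  "\<bar>symb_ss r p\<bar> \<le> 4 * \<alpha>1 / s0\<^sup>2" "\<bar>symb_as r p\<bar> \<le> 2 / s0" "\<bar>symb_aa r p\<bar> \<le> 2"
proof -
  define y where "y = r powr (2 * fst p)"
  define L where "L = ln r"
  define b where "b = snd p"
  note d = y_def[symmetric] L_def[symmetric] b_def[symmetric]
  have y: "1 \<le> y" using r s0 by (simp add: y_def ge_one_powr_ge_zero)
  have b: "0 < b" "b \<le> \<alpha>1" using a by (simp_all add: b_def)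
  have L: "0 \<le> L" "L \<le> y / s0" "L\<^sup>2 \<le> y / s0\<^sup>2"
    using r ln_le_powr by (simp_all add: L_def y_def)
  have D: "0 < y + b" "1 \<le> y + b" "y \<le> y + b" "\<bar>y - b\<bar> \<le> y + b" using y b by auto
  have D2: "y * y \<le> (y + b)\<^sup>2" "y \<le> (y + b)\<^sup>2" "y \<le> (y + b) ^ 3"
  proof -
    show *: "y * y \<le> (y + b)\<^sup>2" using y b D by (simp add: power2_eq_square mult_mono)
    have "y * 1 \<le> y * y" using y by (intro mult_left_mono) auto
    with * show **: "y \<le> (y + b)\<^sup>2" by simp
    have "(y + b)\<^sup>2 \<le> (y + b) ^ 3" using D by (intro power_increasing) auto
    with ** show "y \<le> (y + b) ^ 3" by simp
  qed
  show "\<bar>symb r p\<bar> \<le> 1" using y b by (simp add: symb_def d)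
  show "\<bar>symb_a r p\<bar> \<le> 1" using y b D D2 by (simp add: symb_a_def d)
  show "\<bar>symb_aa r p\<bar> \<le> 2" using y b D D2 by (simp add: symb_aa_def d abs_mult divide_le_eq)
  have yL: "y * L / (y + b)\<^sup>2 \<le> 1 / s0"
  proof -
    have "y * L \<le> y * (y / s0)" using L y by (intro mult_left_mono) auto
    also have "\<dots> \<le> (y + b)\<^sup>2 / s0" using D2(1) s0 by (simp add: divide_right_mono)
    finally show ?thesis using D s0 by (simp add: field_simps)
  qed
  have yL2: "y * L\<^sup>2 / (y + b)\<^sup>2 \<le> 1 / s0\<^sup>2"
  proof -
    have "y * L\<^sup>2 \<le> y * (y / s0\<^sup>2)" using L y by (intro mult_left_mono) auto
    also have "\<dots> \<le> (y + b)\<^sup>2 / s0\<^sup>2" using D2(1) s0 by (simp add: divide_right_mono)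
    finally show ?thesis using D s0 by (simp add: field_simps)
  qed
  have q: "\<bar>y - b\<bar> / (y + b) \<le> 1" using D by simp
  have "\<bar>symb_s r p\<bar> = 2 * b * (y * L / (y + b)\<^sup>2)"
    using y b L by (simp add: symb_s_def d abs_mult)
  also have "\<dots> \<le> 2 * \<alpha>1 * (1 / s0)" using yL b y L by (intro mult_mono) auto
  finally show "\<bar>symb_s r p\<bar> \<le> 2 * \<alpha>1 / s0" by simp
  have "\<bar>symb_as r p\<bar> = 2 * (y * L / (y + b)\<^sup>2) * (\<bar>y - b\<bar> / (y + b))"
    using y b L D by (simp add: symb_as_def d abs_mult power2_eq_square power3_eq_cube)
  also have "\<dots> \<le> 2 * (1 / s0) * 1" using yL q s0 D y L by (intro mult_mono) auto
  finally show "\<bar>symb_as r p\<bar> \<le> 2 / s0" by simp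
  have "\<bar>symb_ss r p\<bar> = 4 * b * (y * L\<^sup>2 / (y + b)\<^sup>2) * (\<bar>y - b\<bar> / (y + b))"
    using y b L D by (simp add: symb_ss_def d abs_mult power2_eq_square power3_eq_cube add.commute)
  also have "\<dots> \<le> 4 * \<alpha>1 * (1 / s0\<^sup>2) * 1" using yL2 q s0 D y b L by (intro mult_mono) auto
  finally show "\<bar>symb_ss r p\<bar> \<le> 4 * \<alpha>1 / s0\<^sup>2" by simp
qed

end

section \<open>Differentiability of the solution map\<close>

text \<open>Some component is a nonzero integer. The symbol bounds thus apply at every nonzero
  frequency.\<close>

lemma knorm_ge_1: "1 \<le> knorm k" if "k \<noteq> 0"
proof -
  from that obtain i where "k $ i \<noteq> 0" by (auto simp: vec_eq_iff)
  then have "1 \<le> \<bar>real_of_int (k $ i)\<bar>" by linarith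
  also have "\<dots> \<le> knorm k"
    unfolding knorm_def using component_le_norm_cart[of "\<chi> i. real_of_int (k $ i)" i] by simp
  finally show ?thesis .
qed

text \<open>Turns bounds on two partial derivatives into one on the total derivative; the factor 2
  comes from estimating each component of \<open>h\<close> by \<open>norm h\<close>.\<close>

lemma abs_combination_le:
  fixes h :: "real \<times> real"
  assumes "\<bar>x\<bar> \<le> B" "\<bar>y\<bar> \<le> B"
  shows "\<bar>fst h * x + snd h * y\<bar> \<le> 2 * B * norm h"
proof -
  have "\<bar>fst h\<bar> \<le> norm h" "\<bar>snd h\<bar> \<le> norm h"
    using norm_fst_le[of "fst h" "snd h"] norm_snd_le[of "snd h" "fst h"] by simp_all
  then have "\<bar>fst h\<bar> * \<bar>x\<bar> \<le> norm h * B" "\<bar>snd h\<bar> * \<bar>y\<bar> \<le> norm h * B"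
    using assms by (auto intro!: mult_mono)
  then show ?thesis using abs_triangle_ineq[of "fst h * x" "snd h * y"] by (simp add: abs_mult mult_ac)
qed

text \<open>Linearity is inherited at each index, and the bound uniform in \<open>k\<close> becomes
  the operator bound \<open>B * l2norm c\<close>.\<close>

lemma l2_bounded_linear_multiplier:
  fixes t :: "'i \<Rightarrow> 'a::real_normed_vector \<Rightarrow> real"
  assumes c: "in_l2 c" and lin: "\<And>k. linear (t k)"
    and bd: "\<And>k h. \<bar>t k h\<bar> \<le> B * norm h" and B: "0 \<le> B"
  shows "l2_bounded_linear (\<lambda>h k. complex_of_real (t k h) * c k)"
    and "\<And>h. l2norm (\<lambda>k. complex_of_real (t k h) * c k) \<le> B * norm h * l2norm c"
proof -
  have le: "cmod (complex_of_real (t k h) * c k) \<le> B * norm h * cmod (c k)" for k h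
    using bd[of k h] by (simp add: norm_mult mult_right_mono)
  have nn: "0 \<le> B * norm h" for h using B by simp
  show n: "l2norm (\<lambda>k. complex_of_real (t k h) * c k) \<le> B * norm h * l2norm c" for h
    by (rule l2_dominated(2)[OF c nn le])
  have "in_l2 (\<lambda>k. complex_of_real (t k h) * c k)" for h
    by (rule l2_dominated(1)[OF c nn le])
  with n show "l2_bounded_linear (\<lambda>h k. complex_of_real (t k h) * c k)"
    unfolding l2_bounded_linear_def
    by (auto simp: linear_add[OF lin] linear_scale[OF lin] fun_eq_iff distrib_left mult_ac intro!: exI[of _ "B * l2norm c"])
qed

section \<open>Multiplier families with uniformly bounded derivatives up to order two\<close>

context
  fixes c :: "int ^ 'd \<Rightarrow> complex" and W :: "(real \<times> real) set" and B :: real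
    and M Ms Ma Mss Mas Maa :: "int ^ 'd \<Rightarrow> real \<times> real \<Rightarrow> real"
  assumes c: "in_l2 c" and W: "convex W"
    and der: "\<And>k p. p \<in> W \<Longrightarrow> (M k has_derivative (\<lambda>h. fst h * Ms k p + snd h * Ma k p)) (at p within W)"
    and der_s: "\<And>k p. p \<in> W \<Longrightarrow> (Ms k has_derivative (\<lambda>h. fst h * Mss k p + snd h * Mas k p)) (at p within W)"
    and der_a: "\<And>k p. p \<in> W \<Longrightarrow> (Ma k has_derivative (\<lambda>h. fst h * Mas k p + snd h * Maa k p)) (at p within W)"
    and bd: "\<And>k p. p \<in> W \<Longrightarrow> \<bar>M k p\<bar> \<le> B" "\<And>k p. p \<in> W \<Longrightarrow> \<bar>Ms k p\<bar> \<le> B" "\<And>k p. p \<in> W \<Longrightarrow> \<bar>Ma k p\<bar> \<le> B"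
      "\<And>k p. p \<in> W \<Longrightarrow> \<bar>Mss k p\<bar> \<le> B" "\<And>k p. p \<in> W \<Longrightarrow> \<bar>Mas k p\<bar> \<le> B" "\<And>k p. p \<in> W \<Longrightarrow> \<bar>Maa k p\<bar> \<le> B"
    and B: "0 \<le> B"
begin

lemma multiplier_in_l2: "p \<in> W \<Longrightarrow> in_l2 (\<lambda>k. complex_of_real (M k p) * c k)"
  by (rule l2_dominated(1)[OF c B]) (simp add: norm_mult mult_right_mono bd)

text \<open>By the mean value inequality all multipliers are Lipschitz on the convex set
  \<open>W\<close> with constant \<open>2 * B\<close>, which makes the map Lipschitz with constant
  \<open>2 * B * l2norm c\<close>.\<close>

lemma multiplier_continuous: "l2_continuous_on W (\<lambda>p k. complex_of_real (M k p) * c k)"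
  unfolding l2_continuous_on_def
proof (intro ballI allI impI)
  fix p and e :: real assume p: "p \<in> W" and e: "0 < e"
  \<comment> \<open>The summand 1 keeps the divisor of the radius positive when \<open>B\<close> or
    \<open>c\<close> vanishes.\<close>
  let ?L = "2 * B * l2norm c + 1"
  have L: "0 < ?L" using B l2norm_nonneg[of c] by (simp add: add_nonneg_pos)
  show "\<exists>d>0. \<forall>q\<in>W. norm (q - p) < d \<longrightarrow>
      l2norm (\<lambda>k. complex_of_real (M k q) * c k - complex_of_real (M k p) * c k) < e"
  proof (intro exI[of _ "e / ?L"] conjI ballI impI)
    show "0 < e / ?L" using e L by simp
    fix q assume q: "q \<in> W" and d: "norm (q - p) < e / ?L"
    have le: "cmod (complex_of_real (M k q) * c k - complex_of_real (M k p) * c k)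
        \<le> 2 * B * norm (q - p) * cmod (c k)" for k
    proof -
      have "norm (M k q - M k p) \<le> 2 * B * norm (q - p)"
      proof (rule differentiable_bound[OF W der _ q p])
        show "onorm (\<lambda>h. fst h * Ms k x + snd h * Ma k x) \<le> 2 * B" if "x \<in> W" for x
          using abs_combination_le[OF bd(2,3)[OF that]] B by (intro onorm_bound) auto
      qed
      then have "\<bar>M k q - M k p\<bar> * cmod (c k) \<le> 2 * B * norm (q - p) * cmod (c k)"
        by (simp add: mult_right_mono)
      then show ?thesis
        by (simp add: left_diff_distrib[symmetric] norm_mult of_real_diff[symmetric] del: of_real_diff)
    qed
    have "l2norm (\<lambda>k. complex_of_real (M k q) * c k - complex_of_real (M k p) * c k)
        \<le> 2 * B * norm (q - p) * l2norm c"
      by (rule l2_dominated(2)[OF c _ le]) (simp add: B)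
    also have "\<dots> \<le> norm (q - p) * ?L" by (simp add: algebra_simps)
    also have "\<dots> < e" using d L by (simp add: pos_less_divide_eq)
    finally show "l2norm (\<lambda>k. complex_of_real (M k q) * c k - complex_of_real (M k p) * c k) < e" .
  qed
qed

text \<open>The factor \<open>c k\<close> pulls out of the remainder, and
  \<open>l2_multiplier_remainder\<close> controls what is left.\<close>

lemma multiplier_frechet:
  assumes p: "p \<in> W"
  shows "l2_has_frechet_within (\<lambda>p k. complex_of_real (M k p) * c k)
    (\<lambda>h k. complex_of_real (fst h * Ms k p + snd h * Ma k p) * c k) W p"
  unfolding l2_has_frechet_within_def
proof (intro conjI allI impI)
  have B2: "0 \<le> 2 * B" using B by simp
  show "l2_bounded_linear (\<lambda>h k. complex_of_real (fst h * Ms k p + snd h * Ma k p) * c k)"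
    by (rule l2_bounded_linear_multiplier(1)[OF c has_derivative_linear[OF der[OF p]] abs_combination_le[OF bd(2,3)[OF p]]])
      (use B in auto)
  fix e :: real assume e: "0 < e"
  obtain d where "d > 0" and d: "\<And>q. q \<in> W \<Longrightarrow> norm (q - p) < d \<Longrightarrow>
      l2norm (\<lambda>k. complex_of_real (M k q - M k p - (fst (q - p) * Ms k p + snd (q - p) * Ma k p)) * c k)
      \<le> e * norm (q - p)"
    using l2_multiplier_remainder[where m = M and m' = "\<lambda>k p h. fst h * Ms k p + snd h * Ma k p",
        OF c W p B2 der abs_combination_le[OF bd(2,3)] e] by blast
  then show "\<exists>d>0. \<forall>q\<in>W. norm (q - p) < d \<longrightarrow>
      l2norm (\<lambda>k. complex_of_real (M k q) * c k - complex_of_real (M k p) * c k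
        - complex_of_real (fst (q - p) * Ms k p + snd (q - p) * Ma k p) * c k) \<le> e * norm (q - p)"
    by (intro exI[of _ d]) (simp add: left_diff_distrib)
qed

text \<open>The first derivative is a combination, with coefficients \<open>fst h\<close> and
  \<open>snd h\<close>, of the families given by \<open>Ms\<close> and \<open>Ma\<close>. Their
  first order remainders, each made small with \<open>e / 2\<close>, therefore bound the operator
  norm.\<close>

lemma multiplier_derivative_frechet:
  assumes p: "p \<in> W"
  shows "op_has_frechet_within (\<lambda>p h k. complex_of_real (fst h * Ms k p + snd h * Ma k p) * c k)
    (\<lambda>h l k. complex_of_real (fst l * (fst h * Mss k p + snd h * Mas k p)
      + snd l * (fst h * Mas k p + snd h * Maa k p)) * c k) W p"
    (is "op_has_frechet_within ?G (\<lambda>h l k. complex_of_real (?t h k l) * c k) W p")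
  unfolding op_has_frechet_within_def
proof (intro conjI allI impI)
  have B2: "0 \<le> 2 * B" using B by simp
  have lin: "linear (?t h k)" for h k
    by (intro linearI) (simp_all add: algebra_simps)
  \<comment> \<open>The combination bound is used twice: on the brackets in \<open>h\<close>, giving
    \<open>2 * B * norm h\<close>, and then on the outer combination in \<open>l\<close>.\<close>
  have tb: "\<bar>?t h k l\<bar> \<le> 2 * (2 * B * norm h) * norm l" for h k l
    by (intro abs_combination_le bd p)
  have nn: "0 \<le> 2 * (2 * B * norm h)" for h :: "real \<times> real" using B by simp
  note bl = l2_bounded_linear_multiplier[OF c lin tb nn]
  show "op_bounded_linear (\<lambda>h l k. complex_of_real (?t h k l) * c k)"
    unfolding op_bounded_linear_def
  proof (intro conjI allI exI[of _ "4 * B * l2norm c"] bl(1))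
    show "l2opnorm (\<lambda>l k. complex_of_real (?t h k l) * c k) \<le> 4 * B * l2norm c * norm h" for h
    proof (rule l2opnorm_le)
      fix l :: "real \<times> real" assume l: "norm l \<le> 1"
      have "l2norm (\<lambda>k. complex_of_real (?t h k l) * c k) \<le> 2 * (2 * B * norm h) * norm l * l2norm c"
        by (rule bl(2))
      also have "\<dots> \<le> 2 * (2 * B * norm h) * 1 * l2norm c"
        using l B l2norm_nonneg by (intro mult_right_mono mult_left_mono nn) auto
      finally show "l2norm (\<lambda>k. complex_of_real (?t h k l) * c k) \<le> 4 * B * l2norm c * norm h"
        by (simp add: mult_ac)
    qed
  qed (auto simp: fun_eq_iff algebra_simps)
  fix e :: real assume "0 < e"
  then have e: "0 < e / 2" by simp
  let ?Rs = "\<lambda>q k. complex_of_real (Ms k q - Ms k p - (fst (q - p) * Mss k p + snd (q - p) * Mas k p)) * c k"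
  let ?Ra = "\<lambda>q k. complex_of_real (Ma k q - Ma k p - (fst (q - p) * Mas k p + snd (q - p) * Maa k p)) * c k"
  obtain d1 where d1: "d1 > 0" "\<And>q. q \<in> W \<Longrightarrow> norm (q - p) < d1 \<Longrightarrow>
      in_l2 (?Rs q) \<and> l2norm (?Rs q) \<le> e / 2 * norm (q - p)"
    using l2_multiplier_remainder[where m = Ms and m' = "\<lambda>k p h. fst h * Mss k p + snd h * Mas k p",
        OF c W p B2 der_s abs_combination_le[OF bd(4,5)] e] by blast
  obtain d2 where d2: "d2 > 0" "\<And>q. q \<in> W \<Longrightarrow> norm (q - p) < d2 \<Longrightarrow>
      in_l2 (?Ra q) \<and> l2norm (?Ra q) \<le> e / 2 * norm (q - p)"
    using l2_multiplier_remainder[where m = Ma and m' = "\<lambda>k p h. fst h * Mas k p + snd h * Maa k p",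
        OF c W p B2 der_a abs_combination_le[OF bd(5,6)] e] by blast
  show "\<exists>d>0. \<forall>q\<in>W. norm (q - p) < d \<longrightarrow>
      l2opnorm (\<lambda>h k. ?G q h k - ?G p h k - complex_of_real (?t (q - p) k h) * c k) \<le> e * norm (q - p)"
  proof (intro exI[of _ "min d1 d2"] conjI ballI impI l2opnorm_le)
    show "0 < min d1 d2" using d1 d2 by simp
    fix q h assume q: "q \<in> W" "norm (q - p) < min d1 d2" and h: "norm (h :: real \<times> real) \<le> 1"
    note Rs = d1(2)[OF q(1)] and Ra = d2(2)[OF q(1)]
    \<comment> \<open>The increment \<open>q - p\<close> fills the first slot of the second
      derivative and \<open>h\<close> the second, so the components of \<open>h\<close> separate the
      two remainders.\<close>
    have eq: "(\<lambda>k. ?G q h k - ?G p h k - complex_of_real (?t (q - p) k h) * c k)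
        = (\<lambda>k. complex_of_real (fst h) * ?Rs q k + complex_of_real (snd h) * ?Ra q k)"
      by (simp add: fun_eq_iff algebra_simps)
    have "l2norm (\<lambda>k. complex_of_real (fst h) * ?Rs q k + complex_of_real (snd h) * ?Ra q k)
        \<le> norm (fst h, snd h) * (l2norm (?Rs q) + l2norm (?Ra q))"
      using Rs Ra q(2) by (intro l2norm_combination_le) auto
    also have "\<dots> \<le> 1 * (e / 2 * norm (q - p) + e / 2 * norm (q - p))"
      using Rs Ra q(2) h by (intro mult_mono add_mono add_nonneg_nonneg l2norm_nonneg) auto
    also have "\<dots> = e * norm (q - p)" by simp
    finally show "l2norm (\<lambda>k. ?G q h k - ?G p h k - complex_of_real (?t (q - p) k h) * c k) \<le> e * norm (q - p)"
      unfolding eq .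
  qed
qed

end

section \<open>Application to the solution map\<close>

theorem theorem2:
  fixes g :: "real ^ 'd \<Rightarrow> complex"
    and s0 s1 \<alpha>0 \<alpha>1 :: real
  assumes "0 < s0" and "s0 < s1" and "0 < \<alpha>0" and "\<alpha>0 < \<alpha>1"
    and "L2_0_torus g"
  defines "W \<equiv> {s0..s1} \<times> {\<alpha>0..\<alpha>1}"
    and "gh \<equiv> fourier_coeff g"
  shows "(\<forall>p\<in>W. in_l2 (solS gh p))
    \<and> l2_continuous_on W (solS gh)
    \<and> (\<forall>p\<in>W. l2_has_frechet_within (solS gh) (DS gh p) W p)
    \<and> (\<forall>p\<in>W. op_has_frechet_within (DS gh) (D2S gh p) W p)"
proof -
  have l2: "in_l2 gh" and gh0: "gh 0 = 0"
    unfolding gh_def using assms(5) by (rule fourier_coeff_in_l2, rule fourier_coeff_zero)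
  \<comment> \<open>At \<open>k = 0\<close> the multiplier is \<open>1\<close>, not \<open>0\<close>; it may be replaced by \<open>0\<close> because \<open>g\<close> has zero mean.\<close>
  define E where "E f k p = (if k = 0 then 0 else f (knorm k) p)"
    for f :: "real \<Rightarrow> real \<times> real \<Rightarrow> real" and k :: "int ^ 'd" and p
  \<comment> \<open>All summands are nonnegative, so the sum dominates each of the symbol
    bounds.\<close>
  define B where "B = 1 + (2 * \<alpha>1 / s0 + (4 * \<alpha>1 / s0\<^sup>2 + (2 / s0 + 2)))"
  have pos: "0 \<le> 2 * \<alpha>1 / s0" "0 \<le> 4 * \<alpha>1 / s0\<^sup>2" "0 \<le> 2 / s0" using assms(1-4) by auto
  then have B: "0 \<le> B" by (simp add: B_def)
  have W: "convex W" unfolding W_def by (intro convex_Times) auto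
  have p: "0 < snd p" "s0 \<le> fst p" "snd p \<le> \<alpha>1" if "p \<in> W" for p
    using that assms(3) by (auto simp: W_def)
  have k: "0 < knorm k" if "k \<noteq> 0" for k :: "int ^ 'd" using knorm_ge_1[OF that] by simp
  have bd: "\<bar>E symb k p\<bar> \<le> B" "\<bar>E symb_s k p\<bar> \<le> B" "\<bar>E symb_a k p\<bar> \<le> B"
    "\<bar>E symb_ss k p\<bar> \<le> B" "\<bar>E symb_as k p\<bar> \<le> B" "\<bar>E symb_aa k p\<bar> \<le> B" if "p \<in> W" for k p
  proof -
    \<comment> \<open>At \<open>k = 0\<close> the extended multiplier vanishes, so an estimate is
      needed only where \<open>knorm k\<close> is at least 1.\<close>
    have le: "\<bar>E f k p\<bar> \<le> B" if "k \<noteq> 0 \<Longrightarrow> \<bar>f (knorm k) p\<bar> \<le> x" "x \<le> B" for f x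
      using that B by (cases "k = 0") (auto simp: E_def)
    note b = symb_abs_le[OF knorm_ge_1 assms(1) p(2,1,3)[OF that]]
    have "1 \<le> B" "2 * \<alpha>1 / s0 \<le> B" "4 * \<alpha>1 / s0\<^sup>2 \<le> B" "2 / s0 \<le> B" "2 \<le> B"
      using pos unfolding B_def by linarith+
    then show "\<bar>E symb k p\<bar> \<le> B"
      "\<bar>E symb_s k p\<bar> \<le> B"
      "\<bar>E symb_a k p\<bar> \<le> B"
      "\<bar>E symb_ss k p\<bar> \<le> B"
      "\<bar>E symb_as k p\<bar> \<le> B"
      "\<bar>E symb_aa k p\<bar> \<le> B"
      by - ((rule le[where f = symb, OF b(1)]
        le[where f = symb_s, OF b(2)]
        le[where f = symb_a, OF b(3)]
        le[where f = symb_ss, OF b(4)]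
        le[where f = symb_as, OF b(5)]
        le[where f = symb_aa, OF b(6)], assumption+)+)
  qed
  have der: "(E symb k has_derivative (\<lambda>h. fst h * E symb_s k p + snd h * E symb_a k p)) (at p within W)"
    "(E symb_s k has_derivative (\<lambda>h. fst h * E symb_ss k p + snd h * E symb_as k p)) (at p within W)"
    "(E symb_a k has_derivative (\<lambda>h. fst h * E symb_as k p + snd h * E symb_aa k p)) (at p within W)"
    if "p \<in> W" for k p
    using symb_has_derivative[OF k p(1)[OF that]] symb_s_has_derivative[OF k p(1)[OF that]]
      symb_a_has_derivative[OF k p(1)[OF that]]
    by (cases "k = 0"; simp add: E_def[abs_def])+
  have sol: "solS gh = (\<lambda>p k. complex_of_real (E symb k p) * gh k)"
    using gh0 by (auto simp: fun_eq_iff solS_def E_def symb_def)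
  have DS: "DS gh = (\<lambda>p h k. complex_of_real (fst h * E symb_s k p + snd h * E symb_a k p) * gh k)"
    by (auto simp: fun_eq_iff DS_def E_def symb_s_def symb_a_def dS_s_def dS_a_def distrib_right mult.assoc)
  have D2S: "D2S gh = (\<lambda>p h l k. complex_of_real (fst l * (fst h * E symb_ss k p + snd h * E symb_as k p)
      + snd l * (fst h * E symb_as k p + snd h * E symb_aa k p)) * gh k)"
  proof (intro ext)
    fix p h l :: "real \<times> real" and k :: "int ^ 'd"
    have "dS_ss gh (fst p) (snd p) k = complex_of_real (E symb_ss k p) * gh k"
      "dS_as gh (fst p) (snd p) k = complex_of_real (E symb_as k p) * gh k"
      "dS_aa gh (fst p) (snd p) k = complex_of_real (E symb_aa k p) * gh k"
      by (simp_all add: dS_ss_def dS_as_def dS_aa_def E_def symb_ss_def symb_as_def symb_aa_def)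
    \<comment> \<open>The two \<open>symb_as\<close> terms, one from each order of the slots, merge
      into the coefficient \<open>h1 * l2 + h2 * l1\<close> of \<open>dS_as\<close>.\<close>
    then show "D2S gh p h l k = complex_of_real (fst l * (fst h * E symb_ss k p + snd h * E symb_as k p)
      + snd l * (fst h * E symb_as k p + snd h * E symb_aa k p)) * gh k"
      by (simp add: D2S_def case_prod_unfold algebra_simps)
  qed
  note facts = l2 W der bd B
  show ?thesis
    unfolding sol DS D2S
    by (intro conjI ballI multiplier_in_l2[OF facts] multiplier_continuous[OF facts]
        multiplier_frechet[OF facts] multiplier_derivative_frechet[OF facts])
qed

end
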